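(* Let $d\ge2$, let $s\ge1$ be an integer, and let $H\hookrightarrow C_0^s(\mathbb{R}^d,\mathbb{R})$ be a Hilbert space of scalar-valued functions with reproducing kernel $K_H:\mathbb{R}^d\times\mathbb{R}^d\to\mathbb{R}$. Let $V:=\{\nabla f\,|\,f\in H\}$ be endowed with the inner product $\langle v_1,v_2\rangle_V:=\langle f_1,f_2\rangle_H$, where $v_1=\nabla f_1$ and $v_2=\nabla f_2$ (the $f\in H$ with $v=\nabla f$ being unique for each $v\in V$). Then $V\hookrightarrow C_0^{s-1}(\mathbb{R}^d,\mathbb{R}^d)$ is a Hilbert space of $\mathbb{R}^d$-valued functions, and its reproducing kernel is $K_V=\nabla_1\nabla_2^TK_H$.
   Context: $C_0^s(\mathbb{R}^d,\mathbb{R}^m)$ is the Banach space of $C^s$ functions $u$ all of whose partial derivatives of order at most $s$ are continuous and vanish at infinity, with norm $\sum_{|p|\le s}\sup_x\|\partial^pu(x)\|$. $X\hookrightarrow Y$ means that $X\subseteq Y$ with continuous inclusion. The reproducing kernel of a Hilbert space $E$ of $\mathbb{R}^m$-valued functions on $\mathbb{R}^d$ on which point evaluations are continuous is the unique $K:\mathbb{R}^d\times\mathbb{R}^d\to\mathbb{R}^{m\times m}$ with $K(\cdot,x)\alpha\in E$ and $\langle K(\cdot,x)\alpha,u\rangle_E=\alpha\cdot u(x)$ for all $u\in E$, $x\in\mathbb{R}^d$, $\alpha\in\mathbb{R}^m$. $\nabla_1\nabla_2^TK_H$ is the matrix-valued function with $(i,j)$ entry $\partial_{1,i}\partial_{2,j}K_H$,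 where $\partial_{n,i}$ is the derivative in the $i$-th coordinate of the $n$-th argument ($n=1,2$). *)

theory Defs
  imports "HOL-Analysis.Analysis"
begin

section \<open>Partial derivatives\<close>

definition partial_differentiable ::
    "'d::finite \<Rightarrow> (real^'d \<Rightarrow> 'b::real_normed_vector) \<Rightarrow> real^'d \<Rightarrow> bool" where
  "partial_differentiable i f x \<longleftrightarrow> (\<lambda>t::real. f (x + t *\<^sub>R axis i 1)) differentiable (at 0)"

definition partial_deriv ::
    "'d::finite \<Rightarrow> (real^'d \<Rightarrow> 'b::real_normed_vector) \<Rightarrow> real^'d \<Rightarrow> 'b" where
  "partial_deriv i f x = vector_derivative (\<lambda>t::real. f (x + t *\<^sub>R axis i 1)) (at 0)"

primrec iter_partial ::
    "'d::finite list \<Rightarrow> (real^'d \<Rightarrow> 'b::real_normed_vector) \<Rightarrow> real^'d \<Rightarrow> 'b" where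
  "iter_partial [] f = f"
| "iter_partial (i # js) f = partial_deriv i (iter_partial js f)"

text \<open>
  A multi-index is a function \<open>p :: 'd \<Rightarrow> nat\<close>. The index type carries no order, so an arbitrary
  order of differentiation is chosen; for \<open>C\<^sup>s\<close> functions and \<open>\<bar>p\<bar> \<le> s\<close> the choice is immaterial
  because mixed partial derivatives commute.
\<close>

definition multi_partial ::
    "('d::finite \<Rightarrow> nat) \<Rightarrow> (real^'d \<Rightarrow> 'b::real_normed_vector) \<Rightarrow> real^'d \<Rightarrow> 'b" where
  "multi_partial p f = iter_partial (SOME js. \<forall>i. count_list js i = p i) f"

definition grad :: "(real^'d::finite \<Rightarrow> real) \<Rightarrow> real^'d \<Rightarrow> real^'d" where
  "grad f x = (\<chi> i. partial_deriv i f x)"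

section \<open>The spaces of \<open>C\<^sup>s\<close> functions vanishing at infinity\<close>

definition C0 :: "nat \<Rightarrow> (real^'d::finite \<Rightarrow> 'b::real_normed_vector) set" where
  "C0 s = {u. (\<forall>js i x. length js < s \<longrightarrow> partial_differentiable i (iter_partial js u) x) \<and>
              (\<forall>js. length js \<le> s \<longrightarrow> continuous_on UNIV (iter_partial js u) \<and>
                                     (iter_partial js u \<longlongrightarrow> 0) at_infinity)}"

definition C0_norm :: "nat \<Rightarrow> (real^'d::finite \<Rightarrow> 'b::real_normed_vector) \<Rightarrow> real" where
  "C0_norm s u = (\<Sum>p | (\<Sum>i\<in>UNIV. p i) \<le> s. SUP x. norm (multi_partial p u x))"

section \<open>Hilbert spaces of functions\<close>

definition ip_norm :: "('f \<Rightarrow> 'f \<Rightarrow> real) \<Rightarrow> 'f \<Rightarrow> real" where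
  "ip_norm ip f = sqrt (ip f f)"

text \<open>The vector space structure is the pointwise one; \<open>ip\<close> is only meaningful on \<open>E\<close>.\<close>

locale function_hilbert_space =
  fixes E :: "('a \<Rightarrow> 'b::real_vector) set"
    and ip :: "('a \<Rightarrow> 'b) \<Rightarrow> ('a \<Rightarrow> 'b) \<Rightarrow> real"
  assumes zero_closed: "(\<lambda>x. 0) \<in> E"
    and add_closed: "\<lbrakk>f \<in> E; g \<in> E\<rbrakk> \<Longrightarrow> (\<lambda>x. f x + g x) \<in> E"
    and scale_closed: "f \<in> E \<Longrightarrow> (\<lambda>x. c *\<^sub>R f x) \<in> E"
    and ip_commute: "\<lbrakk>f \<in> E; g \<in> E\<rbrakk> \<Longrightarrow> ip f g = ip g f"
    and ip_add_left: "\<lbrakk>f \<in> E; g \<in> E; h \<in> E\<rbrakk> \<Longrightarrow> ip (\<lambda>x. f x + g x) h = ip f h + ip g h"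
    and ip_scale_left: "\<lbrakk>f \<in> E; g \<in> E\<rbrakk> \<Longrightarrow> ip (\<lambda>x. c *\<^sub>R f x) g = c * ip f g"
    and ip_nonneg: "f \<in> E \<Longrightarrow> 0 \<le> ip f f"
    and ip_definite: "\<lbrakk>f \<in> E; ip f f = 0\<rbrakk> \<Longrightarrow> f = (\<lambda>x. 0)"
    and complete: "\<lbrakk>\<And>n. S n \<in> E;
        \<And>e. 0 < e \<Longrightarrow> \<exists>N. \<forall>m\<ge>N. \<forall>n\<ge>N. ip_norm ip (\<lambda>x. S m x - S n x) < e\<rbrakk>
        \<Longrightarrow> \<exists>f\<in>E. (\<lambda>n. ip_norm ip (\<lambda>x. S n x - f x)) \<longlonglongrightarrow> 0"

definition continuously_included ::
    "('a \<Rightarrow> 'b::real_vector) set \<Rightarrow> (('a \<Rightarrow> 'b) \<Rightarrow> real) \<Rightarrow>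
     ('a \<Rightarrow> 'b) set \<Rightarrow> (('a \<Rightarrow> 'b) \<Rightarrow> real) \<Rightarrow> bool" where
  "continuously_included X normX Y normY \<longleftrightarrow>
     X \<subseteq> Y \<and>
     (\<forall>f\<in>X. \<forall>e>0. \<exists>\<delta>>0. \<forall>g\<in>X. normX (\<lambda>x. g x - f x) < \<delta> \<longrightarrow> normY (\<lambda>x. g x - f x) < e)"

section \<open>Reproducing kernels\<close>

text \<open>
  \<open>act\<close> is the action of kernel values on vectors: \<open>(*v)\<close> for matrix-valued kernels of spaces of
  \<open>real^'m\<close>-valued functions, and \<open>(*)\<close> for scalar kernels of spaces of real-valued functions,
  where 1-by-1 matrices are identified with reals. Continuity of the point evaluations is not
  listed, as it follows from the reproducing property by the Cauchy--Schwarz inequality.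
\<close>

definition has_reproducing_property ::
    "('k \<Rightarrow> 'b \<Rightarrow> 'b) \<Rightarrow> ('a \<Rightarrow> 'b::real_inner) set \<Rightarrow> (('a \<Rightarrow> 'b) \<Rightarrow> ('a \<Rightarrow> 'b) \<Rightarrow> real) \<Rightarrow>
     ('a \<Rightarrow> 'a \<Rightarrow> 'k) \<Rightarrow> bool" where
  "has_reproducing_property act E ip K \<longleftrightarrow>
     (\<forall>x \<alpha>. (\<lambda>y. act (K y x) \<alpha>) \<in> E \<and> (\<forall>u\<in>E. ip (\<lambda>y. act (K y x) \<alpha>) u = \<alpha> \<bullet> u x))"

definition is_reproducing_kernel ::
    "('k \<Rightarrow> 'b \<Rightarrow> 'b) \<Rightarrow> ('a \<Rightarrow> 'b::real_inner) set \<Rightarrow> (('a \<Rightarrow> 'b) \<Rightarrow> ('a \<Rightarrow> 'b) \<Rightarrow> real) \<Rightarrow>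
     ('a \<Rightarrow> 'a \<Rightarrow> 'k) \<Rightarrow> bool" where
  "is_reproducing_kernel act E ip K \<longleftrightarrow>
     has_reproducing_property act E ip K \<and>
     (\<forall>K'. has_reproducing_property act E ip K' \<longrightarrow> K' = K)"

section \<open>Spaces of gradients\<close>

definition grad_space :: "(real^'d::finite \<Rightarrow> real) set \<Rightarrow> (real^'d \<Rightarrow> real^'d) set" where
  "grad_space H = {grad f | f. f \<in> H}"

text \<open>\<open>the_inv_into H grad v\<close> is the \<open>f \<in> H\<close> with \<open>grad f = v\<close>, provided \<open>grad\<close> is injective on \<open>H\<close>.\<close>

definition grad_ip ::
    "(real^'d::finite \<Rightarrow> real) set \<Rightarrow> ((real^'d \<Rightarrow> real) \<Rightarrow> (real^'d \<Rightarrow> real) \<Rightarrow> real) \<Rightarrow>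
     (real^'d \<Rightarrow> real^'d) \<Rightarrow> (real^'d \<Rightarrow> real^'d) \<Rightarrow> real" where
  "grad_ip H ip v w = ip (the_inv_into H grad v) (the_inv_into H grad w)"

text \<open>
  The derivative in the second argument is taken first; \<open>kernel_partials_exist\<close> says that all the
  derivatives occurring in \<open>grad1_grad2T\<close> exist.
\<close>

definition grad1_grad2T ::
    "(real^'d::finite \<Rightarrow> real^'d \<Rightarrow> real) \<Rightarrow> real^'d \<Rightarrow> real^'d \<Rightarrow> real^'d^'d" where
  "grad1_grad2T K x y = (\<chi> i j. partial_deriv i (\<lambda>x'. partial_deriv j (\<lambda>y'. K x' y') y) x)"

definition kernel_partials_exist :: "(real^'d::finite \<Rightarrow> real^'d \<Rightarrow> real) \<Rightarrow> bool" where
  "kernel_partials_exist K \<longleftrightarrow>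
     (\<forall>j x y. partial_differentiable j (\<lambda>y'. K x y') y) \<and>
     (\<forall>i j x y. partial_differentiable i (\<lambda>x'. partial_deriv j (\<lambda>y'. K x' y') y) x)"

end

(*
  The gradient is linear, and injective on H because a function of H with a vanishing partial
  derivative is constant along lines and tends to 0 at infinity; so V is an isometric copy of H.
  Its inclusion in C0 (s - 1) is continuous because the derivatives of grad f are derivatives of f,
  up to the order of differentiation. For the kernel, f |-> (d_j f)(y) is a bounded functional on H,
  so it is represented by some g in H; evaluating g with the reproducing property of K_H and the
  symmetry of K_H gives g(x) = d_{2,j} K_H(x, y). Hence d_{2,j} K_H(., y) is a differentiable function
  in H, and grad (sum_j alpha_j g_j) = K_V(., y) alpha represents f |-> alpha . grad f(y).
*)
theory Submission
  imports Defs "HOL-Library.Multiset"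
begin

section \<open>Inner product algebra, Riesz representation, isometric images, uniqueness of
  kernels\<close>

section \<open>Hilbert spaces of functions\<close>

context function_hilbert_space
begin

lemma diff_closed:
  assumes "f \<in> E" "g \<in> E" shows "(\<lambda>x. f x - g x) \<in> E"
  using add_closed[OF assms(1) scale_closed[OF assms(2), of "-1"]] by simp

lemma ip_add_right:
  assumes "f \<in> E" "g \<in> E" "h \<in> E" shows "ip h (\<lambda>x. f x + g x) = ip h f + ip h g"
  using ip_add_left[OF assms] ip_commute[OF add_closed[OF assms(1,2)] assms(3)]
    ip_commute[OF assms(1,3)] ip_commute[OF assms(2,3)] by simp

lemma ip_scale_right:
  assumes "f \<in> E" "g \<in> E" shows "ip g (\<lambda>x. c *\<^sub>R f x) = c * ip g f"
  using ip_scale_left[OF assms] ip_commute[OF scale_closed[OF assms(1)] assms(2)]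
    ip_commute[OF assms] by simp

lemma ip_diff_left:
  assumes "f \<in> E" "g \<in> E" "h \<in> E" shows "ip (\<lambda>x. f x - g x) h = ip f h - ip g h"
  using ip_add_left[OF assms(1) scale_closed[OF assms(2), of "-1"] assms(3)]
    ip_scale_left[OF assms(2,3), of "-1"] by simp

lemma ip_zero_left: "f \<in> E \<Longrightarrow> ip (\<lambda>x. 0) f = 0"
  using ip_scale_left[of "\<lambda>x. 0" f 0] zero_closed by simp

lemma sum_closed:
  assumes "\<And>i. i \<in> I \<Longrightarrow> f i \<in> E" shows "(\<lambda>x. \<Sum>i\<in>I. f i x) \<in> E"
  using assms by (induction I rule: infinite_finite_induct) (auto intro: zero_closed add_closed)

lemma ip_sum_left:
  assumes "\<And>i. i \<in> I \<Longrightarrow> f i \<in> E" "g \<in> E"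
  shows "ip (\<lambda>x. \<Sum>i\<in>I. f i x) g = (\<Sum>i\<in>I. ip (f i) g)"
  using assms
  by (induction I rule: infinite_finite_induct) (auto simp: ip_zero_left ip_add_left sum_closed)

text \<open>The expansion behind Cauchy-Schwarz, the squared distance and the variational argument
  of the representation theorem.\<close>

lemma ip_quadratic:
  assumes "f \<in> E" "g \<in> E"
  shows "ip (\<lambda>x. f x + t *\<^sub>R g x) (\<lambda>x. f x + t *\<^sub>R g x) = ip f f + 2 * t * ip f g + t\<^sup>2 * ip g g"
proof -
  have s: "(\<lambda>x. t *\<^sub>R g x) \<in> E" using assms scale_closed by blast
  have "ip (\<lambda>x. f x + t *\<^sub>R g x) h = ip f h + t * ip g h" if "h \<in> E" for h
    using ip_add_left[OF assms(1) s that] ip_scale_left[OF assms(2) that] by simp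
  moreover have "ip h (\<lambda>x. f x + t *\<^sub>R g x) = ip h f + t * ip h g" if "h \<in> E" for h
    using ip_add_right[OF assms(1) s that] ip_scale_right[OF assms(2) that] by simp
  ultimately show ?thesis
    using assms ip_commute[OF assms(2,1)] add_closed[OF assms(1) s]
    by (simp add: power2_eq_square distrib_left)
qed

lemma ip_Cauchy_Schwarz:
  assumes "f \<in> E" "g \<in> E"
  shows "\<bar>ip f g\<bar> \<le> ip_norm ip f * ip_norm ip g"
proof (cases "ip g g = 0")
  case True
  then have "ip f g = 0"
    using ip_definite[OF assms(2)] ip_zero_left[OF assms(1)] ip_commute[OF assms] by metis
  then show ?thesis by (simp add: ip_norm_def ip_nonneg assms)
next
  case False
  then have pos: "ip g g > 0" using ip_nonneg[OF assms(2)] by simp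
  \<comment> \<open>The minimiser of the quadratic in \<open>t\<close>; its minimum is
    \<open>ip f f\<close> minus the square of \<open>ip f g\<close> over
    \<open>ip g g\<close>.\<close>
  define t where "t = - ip f g / ip g g"
  have "0 \<le> ip (\<lambda>x. f x + t *\<^sub>R g x) (\<lambda>x. f x + t *\<^sub>R g x)"
    by (intro ip_nonneg add_closed scale_closed assms)
  also have "\<dots> = ip f f + 2 * t * ip f g + t\<^sup>2 * ip g g"
    by (rule ip_quadratic[OF assms])
  also have "\<dots> = ip f f - (ip f g)\<^sup>2 / ip g g"
    using pos by (simp add: t_def power2_eq_square)
  finally have "(ip f g)\<^sup>2 \<le> ip f f * ip g g"
    using pos by (simp add: pos_divide_le_eq)
  then have "sqrt ((ip f g)\<^sup>2) \<le> sqrt (ip f f * ip g g)" by (rule real_sqrt_le_mono)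
  then show ?thesis by (simp add: ip_norm_def real_sqrt_mult)
qed

lemma ip_norm_diff_sq:
  assumes "f \<in> E" "g \<in> E"
  shows "(ip_norm ip (\<lambda>x. f x - g x))\<^sup>2 = ip f f - 2 * ip f g + ip g g"
  using ip_quadratic[OF assms, of "-1"] ip_nonneg[OF diff_closed[OF assms]]
  by (simp add: ip_norm_def)

text \<open>By homogeneity a bound near zero is a global one: \<open>f\<close> is rescaled to norm
  \<delta>/2, inside the open ball, whence the factor 2. Such a local bound is what a continuous
  inclusion supplies.\<close>

lemma linear_functional_bounded:
  assumes scale: "\<And>f c. f \<in> E \<Longrightarrow> L (\<lambda>x. c *\<^sub>R f x) = c * L f"
    and small: "\<delta> > 0" "\<And>f. \<lbrakk>f \<in> E; ip_norm ip f < \<delta>\<rbrakk> \<Longrightarrow> \<bar>L f\<bar> \<le> 1"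
    and f: "f \<in> E"
  shows "\<bar>L f\<bar> \<le> 2 / \<delta> * ip_norm ip f"
proof (cases "ip f f = 0")
  case True
  then have "L f = 0" using ip_definite[OF f True] scale[OF f, of 0] by simp
  then show ?thesis using small(1) by (simp add: ip_norm_def ip_nonneg f)
next
  case False
  define n where "n = ip_norm ip f"
  have n: "n > 0" using False ip_nonneg[OF f] by (simp add: n_def ip_norm_def)
  define c where "c = \<delta> / (2 * n)"
  have c: "c > 0" using n small(1) by (simp add: c_def)
  have "ip_norm ip (\<lambda>x. c *\<^sub>R f x) = c * n"
    using c f by (simp add: ip_norm_def n_def ip_scale_left ip_scale_right scale_closed real_sqrt_mult)
  also have "\<dots> < \<delta>" using n small(1) by (simp add: c_def)
  finally have "\<bar>c * L f\<bar> \<le> 1" using small(2) scale_closed[OF f] scale[OF f] by metis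
  then have "c * \<bar>L f\<bar> \<le> 1" using c by (simp add: abs_mult)
  then show ?thesis using n small(1) by (simp add: c_def n_def[symmetric] field_simps)
qed

text \<open>The representing element is the minimiser of \<open>ip f f - 2 * L f\<close>.\<close>

theorem riesz_representation:
  assumes add: "\<And>f g. \<lbrakk>f \<in> E; g \<in> E\<rbrakk> \<Longrightarrow> L (\<lambda>x. f x + g x) = L f + L g"
    and scale: "\<And>f c. f \<in> E \<Longrightarrow> L (\<lambda>x. c *\<^sub>R f x) = c * L f"
    and bound: "\<And>f. f \<in> E \<Longrightarrow> \<bar>L f\<bar> \<le> C * ip_norm ip f"
  shows "\<exists>g\<in>E. \<forall>f\<in>E. ip g f = L f"
proof -
  define Q where "Q f = ip f f - 2 * L f" for f
  \<comment> \<open>Completing the square: with \<open>n\<close> the norm of \<open>f\<close>,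
    \<open>Q f\<close> is at least n^2 - 2 C n.\<close>
  have Q_ge: "- C\<^sup>2 \<le> Q f" if "f \<in> E" for f
  proof -
    have "ip f f = (ip_norm ip f)\<^sup>2" by (simp add: ip_norm_def ip_nonneg that)
    moreover have "0 \<le> (ip_norm ip f - C)\<^sup>2" by simp
    ultimately show ?thesis
      using bound[OF that] by (simp add: Q_def power2_diff algebra_simps)
  qed
  define m where "m = Inf (Q ` E)"
  have bdd: "bdd_below (Q ` E)" using Q_ge by fast
  have m_le: "m \<le> Q f" if "f \<in> E" for f
    unfolding m_def using bdd that by (simp add: cInf_lower)
  have "\<exists>f\<in>E. Q f < m + 1 / real (Suc n)" for n
  proof -
    have "Inf (Q ` E) < m + 1 / real (Suc n)" by (simp add: m_def)
    then show ?thesis using cInf_lessD[of "Q ` E"] zero_closed by blast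
  qed
  then obtain S where S: "\<And>n. S n \<in> E" and QS: "\<And>n. Q (S n) < m + 1 / real (Suc n)" by metis
  \<comment> \<open>Parallelogram law: at the midpoint \<open>u\<close> the terms in
    \<open>L\<close> cancel, so the left side equals 2 Q f + 2 Q g - 4 Q u, and
    \<open>m \<le> Q u\<close>. Hence minimising sequences are Cauchy.\<close>
  have close: "(ip_norm ip (\<lambda>x. f x - g x))\<^sup>2 \<le> 2 * (Q f + Q g - 2 * m)"
    if f: "f \<in> E" and g: "g \<in> E" for f g
  proof -
    define u where "u = (\<lambda>x. (1/2) *\<^sub>R (f x + 1 *\<^sub>R g x))"
    have fg: "(\<lambda>x. f x + 1 *\<^sub>R g x) \<in> E" using add_closed[OF f g] by simp
    have u: "u \<in> E" unfolding u_def using scale_closed[OF fg] .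
    have "ip u u = (ip f f + 2 * ip f g + ip g g) / 4"
      unfolding u_def ip_scale_left[OF fg scale_closed[OF fg]] ip_scale_right[OF fg fg]
        ip_quadratic[OF f g] by simp
    moreover have "L u = (L f + L g) / 2"
      unfolding u_def using scale[OF fg] add[OF f g] by simp
    ultimately show ?thesis
      using m_le[OF u] unfolding ip_norm_diff_sq[OF f g] by (simp add: Q_def)
  qed
  have "\<exists>N. \<forall>m\<ge>N. \<forall>n\<ge>N. ip_norm ip (\<lambda>x. S m x - S n x) < e" if e: "0 < e" for e
  proof -
    \<comment> \<open>Beyond \<open>N\<close> each value of \<open>Q\<close> exceeds
      \<open>m\<close> by less than e^2/4, so \<open>close\<close> bounds the squared distance by
      e^2.\<close>
    obtain N where N: "1 / real (Suc N) < e\<^sup>2 / 4"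
      using e nat_approx_posE[of "e\<^sup>2 / 4"] by auto
    have "ip_norm ip (\<lambda>x. S k x - S l x) < e" if "k \<ge> N" "l \<ge> N" for k l
    proof -
      have "1 / real (Suc k) \<le> 1 / real (Suc N)" "1 / real (Suc l) \<le> 1 / real (Suc N)"
        using that by (auto intro!: divide_left_mono)
      then have "(ip_norm ip (\<lambda>x. S k x - S l x))\<^sup>2 < e\<^sup>2"
        using close[OF S S, of k l] QS[of k] QS[of l] N by argo
      then show ?thesis using e by (simp add: power2_less_imp_less)
    qed
    then show ?thesis by blast
  qed
  then obtain g where g: "g \<in> E" and lim: "(\<lambda>n. ip_norm ip (\<lambda>x. S n x - g x)) \<longlonglongrightarrow> 0"
    using complete S by blast
  have "ip g f = L f" if f: "f \<in> E" for f
  proof -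
    have ip_lim: "(\<lambda>n. ip (S n) f) \<longlonglongrightarrow> ip g f"
    proof (rule LIM_zero_cancel, rule Lim_null_comparison)
      show "\<forall>\<^sub>F n in sequentially. norm (ip (S n) f - ip g f)
          \<le> ip_norm ip (\<lambda>x. S n x - g x) * ip_norm ip f"
        using ip_Cauchy_Schwarz[OF diff_closed[OF S g] f] ip_diff_left[OF S g f] by simp
      show "(\<lambda>n. ip_norm ip (\<lambda>x. S n x - g x) * ip_norm ip f) \<longlonglongrightarrow> 0"
        using tendsto_mult_right[OF lim, of "ip_norm ip f"] by simp
    qed
    \<comment> \<open>Minimality of \<open>g\<close> along the line in direction \<open>f\<close>.
      It is proved for \<open>S n\<close> with slack 1/(n+1) and passed to the limit, where only the
      convergence of \<open>ip (S n) f\<close> enters.\<close>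
    have nonneg: "0 \<le> 2 * t * (ip g f - L f) + t\<^sup>2 * ip f f" for t
    proof (rule LIMSEQ_le_const)
      show "(\<lambda>n. 1 / real (Suc n) + 2 * t * (ip (S n) f - L f) + t\<^sup>2 * ip f f)
          \<longlonglongrightarrow> 2 * t * (ip g f - L f) + t\<^sup>2 * ip f f"
        using tendsto_add[OF tendsto_add[OF LIMSEQ_inverse_real_of_nat
              tendsto_mult_left[OF tendsto_diff[OF ip_lim tendsto_const[of "L f"]], of "2 * t"]]
            tendsto_const[of "t\<^sup>2 * ip f f"]]
        by (simp add: inverse_eq_divide)
      have "0 \<le> 1 / real (Suc n) + 2 * t * (ip (S n) f - L f) + t\<^sup>2 * ip f f" for n
      proof -
        have "m \<le> Q (\<lambda>x. S n x + t *\<^sub>R f x)"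
          using m_le add_closed[OF S scale_closed[OF f]] .
        also have "\<dots> = Q (S n) + 2 * t * (ip (S n) f - L f) + t\<^sup>2 * ip f f"
          using S f by (simp add: Q_def ip_quadratic add scale scale_closed algebra_simps)
        finally show ?thesis using QS[of n] by linarith
      qed
      then show "\<exists>N. \<forall>n\<ge>N. 0 \<le> 1 / real (Suc n) + 2 * t * (ip (S n) f - L f) + t\<^sup>2 * ip f f"
        by blast
    qed
    \<comment> \<open>The choice t = -b/a makes the quadratic equal to -b^2 (a+1)/a^2, which forces
      b = 0. The summand 1 in \<open>a\<close> keeps the denominator positive when \<open>f\<close>
      is zero.\<close>
    define b where "b = ip g f - L f"
    define a where "a = ip f f + 1"
    have a: "a > 0" using ip_nonneg[OF f] by (simp add: a_def)
    have "0 \<le> 2 * (- b / a) * b + (- b / a)\<^sup>2 * (a - 1)"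
      using nonneg[of "- b / a"] by (simp add: a_def b_def)
    also have "\<dots> = - (b\<^sup>2 * (a + 1) / a\<^sup>2)"
      using a by (simp add: field_simps power2_eq_square)
    finally have "b\<^sup>2 * (a + 1) \<le> 0"
      using a by (simp add: divide_le_0_iff)
    then have "b\<^sup>2 \<le> 0" using a by (simp add: mult_le_0_iff)
    then show ?thesis by (simp add: b_def)
  qed
  then show ?thesis using g by blast
qed

end

text \<open>Each axiom is pulled back along the linear isometry \<open>T\<close>. For completeness,
  preimages of a Cauchy sequence are again Cauchy, and \<open>T\<close> carries their limit to a
  limit.\<close>

lemma function_hilbert_space_image:
  assumes "function_hilbert_space E ip"
    and add: "\<And>f g. \<lbrakk>f \<in> E; g \<in> E\<rbrakk> \<Longrightarrow> T (\<lambda>x. f x + g x) = (\<lambda>x. T f x + T g x)"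
    and scale: "\<And>f c. f \<in> E \<Longrightarrow> T (\<lambda>x. c *\<^sub>R f x) = (\<lambda>x. c *\<^sub>R T f x)"
    and isometry: "\<And>f g. \<lbrakk>f \<in> E; g \<in> E\<rbrakk> \<Longrightarrow> ip' (T f) (T g) = ip f g"
  shows "function_hilbert_space (T ` E) ip'"
proof -
  interpret function_hilbert_space E ip by fact
  have zero: "T (\<lambda>x. 0) = (\<lambda>x. 0)" using scale[OF zero_closed, of 0] by simp
  have diff: "T (\<lambda>x. f x - g x) = (\<lambda>x. T f x - T g x)" if "f \<in> E" "g \<in> E" for f g
    using add[OF that(1) scale_closed[OF that(2), of "-1"]] scale[OF that(2), of "-1"] by simp
  have norm: "ip_norm ip' (\<lambda>x. T f x - T g x) = ip_norm ip (\<lambda>x. f x - g x)"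
    if "f \<in> E" "g \<in> E" for f g
    using isometry[OF diff_closed diff_closed, OF that that] diff[OF that]
    by (simp add: ip_norm_def)
  show ?thesis
  proof
    show "(\<lambda>x. 0) \<in> T ` E" using zero zero_closed by (intro image_eqI[of _ T]) auto
  next
    fix v w assume "v \<in> T ` E" "w \<in> T ` E"
    then obtain f g where fg: "f \<in> E" "g \<in> E" "v = T f" "w = T g" by blast
    then have "(\<lambda>x. v x + w x) = T (\<lambda>x. f x + g x)" using add by simp
    then show "(\<lambda>x. v x + w x) \<in> T ` E" using add_closed fg by blast
  next
    fix v c assume "v \<in> T ` E"
    then obtain f where f: "f \<in> E" "v = T f" by blast
    then have "(\<lambda>x. c *\<^sub>R v x) = T (\<lambda>x. c *\<^sub>R f x)" using scale by simp
    then show "(\<lambda>x. c *\<^sub>R v x) \<in> T ` E" using scale_closed f by blast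
  next
    fix v w assume "v \<in> T ` E" "w \<in> T ` E"
    then show "ip' v w = ip' w v" using isometry ip_commute by auto
  next
    fix u v w assume "u \<in> T ` E" "v \<in> T ` E" "w \<in> T ` E"
    then obtain f g h where fgh: "f \<in> E" "g \<in> E" "h \<in> E" "u = T f" "v = T g" "w = T h" by blast
    have "ip' (\<lambda>x. u x + v x) w = ip (\<lambda>x. f x + g x) h"
      using isometry[OF add_closed[OF fgh(1,2)] fgh(3)] add[OF fgh(1,2)] fgh(4-6) by simp
    then show "ip' (\<lambda>x. u x + v x) w = ip' u w + ip' v w"
      using ip_add_left isometry fgh by simp
  next
    fix v w c assume "v \<in> T ` E" "w \<in> T ` E"
    then obtain f g where fg: "f \<in> E" "g \<in> E" "v = T f" "w = T g" by blast
    have "ip' (\<lambda>x. c *\<^sub>R v x) w = ip (\<lambda>x. c *\<^sub>R f x) g"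
      using isometry[OF scale_closed[OF fg(1)] fg(2)] scale[OF fg(1)] fg(3,4) by simp
    then show "ip' (\<lambda>x. c *\<^sub>R v x) w = c * ip' v w"
      using ip_scale_left isometry fg by simp
  next
    fix v assume "v \<in> T ` E"
    then show "0 \<le> ip' v v" using isometry ip_nonneg by auto
  next
    fix v assume "v \<in> T ` E" "ip' v v = 0"
    then obtain f where f: "f \<in> E" "v = T f" "ip f f = 0" using isometry by auto
    then show "v = (\<lambda>x. 0)" using ip_definite[of f] zero by simp
  next
    fix S :: "nat \<Rightarrow> _"
    assume S: "\<And>n. S n \<in> T ` E"
      and cauchy: "\<And>e. 0 < e \<Longrightarrow> \<exists>N. \<forall>m\<ge>N. \<forall>n\<ge>N. ip_norm ip' (\<lambda>x. S m x - S n x) < e"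
    have "\<forall>n. \<exists>f. f \<in> E \<and> S n = T f" using S by blast
    then obtain F where F: "\<And>n. F n \<in> E" and SF: "\<And>n. S n = T (F n)" by metis
    have "\<exists>N. \<forall>m\<ge>N. \<forall>n\<ge>N. ip_norm ip (\<lambda>x. F m x - F n x) < e" if "0 < e" for e
      using cauchy[OF that] by (simp add: SF norm F)
    then obtain f where "f \<in> E" "(\<lambda>n. ip_norm ip (\<lambda>x. F n x - f x)) \<longlonglongrightarrow> 0"
      using complete F by blast
    then show "\<exists>v\<in>T ` E. (\<lambda>n. ip_norm ip' (\<lambda>x. S n x - v x)) \<longlonglongrightarrow> 0"
      by (auto simp: SF norm F intro!: bexI[of _ f])
  qed
qed

text \<open>The difference of the two representers is orthogonal to all of \<open>E\<close>, in
  particular to itself. As \<open>act\<close> is arbitrary, the conclusion concerns its values and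
  not the kernels themselves.\<close>

lemma has_reproducing_property_unique:
  assumes "function_hilbert_space E ip"
    and K: "has_reproducing_property act E ip K" and K': "has_reproducing_property act E ip K'"
  shows "act (K y x) \<alpha> = act (K' y x) \<alpha>"
proof -
  interpret function_hilbert_space E ip by fact
  let ?u = "\<lambda>y. act (K y x) \<alpha>" and ?v = "\<lambda>y. act (K' y x) \<alpha>"
  have uv: "?u \<in> E" "?v \<in> E" and eq: "ip ?u w = ip ?v w" if "w \<in> E" for w
    using K K' that unfolding has_reproducing_property_def by auto
  have mem: "?u \<in> E" "?v \<in> E" using uv[OF zero_closed] by auto
  have "ip (\<lambda>x. ?u x - ?v x) (\<lambda>x. ?u x - ?v x) = 0"
    using eq[OF diff_closed[OF mem]] ip_diff_left[OF mem diff_closed[OF mem]] by simp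
  then have "(\<lambda>x. ?u x - ?v x) = (\<lambda>x. 0)" using ip_definite diff_closed[OF mem] by blast
  then show ?thesis by (metis eq_iff_diff_eq_0)
qed

section \<open>Calculus along coordinate lines and the symmetry of mixed second derivatives\<close>

section \<open>Partial derivatives\<close>

text \<open>The definition differentiates at parameter 0 only; shifting the base point gives the
  derivative at every parameter of the line, as the mean value theorem requires.\<close>

lemma has_vector_derivative_partial_deriv:
  assumes "partial_differentiable i f (x + t *\<^sub>R axis i 1)"
  shows "((\<lambda>r. f (x + r *\<^sub>R axis i 1)) has_vector_derivative
    partial_deriv i f (x + t *\<^sub>R axis i 1)) (at t)"
proof -
  let ?g = "\<lambda>r. f (x + t *\<^sub>R axis i 1 + r *\<^sub>R axis i 1)"
  have "(?g has_vector_derivative partial_deriv i f (x + t *\<^sub>R axis i 1)) (at (t - t))"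
    using assms by (simp add: partial_differentiable_def partial_deriv_def vector_derivative_works)
  moreover have "((\<lambda>r. r - t) has_vector_derivative 1) (at t)"
    by (auto intro!: derivative_eq_intros)
  ultimately have "(?g \<circ> (\<lambda>r. r - t) has_vector_derivative
      1 *\<^sub>R partial_deriv i f (x + t *\<^sub>R axis i 1)) (at t)"
    using vector_diff_chain_at by blast
  moreover have "?g \<circ> (\<lambda>r. r - t) = (\<lambda>r. f (x + r *\<^sub>R axis i 1))"
    by (auto simp: fun_eq_iff algebra_simps)
  ultimately show ?thesis by simp
qed

lemma partial_deriv_eqI:
  assumes "((\<lambda>t. f (x + t *\<^sub>R axis i 1)) has_vector_derivative D) (at 0)"
  shows "partial_differentiable i f x" "partial_deriv i f x = D"
  using assms
  by (auto simp: partial_differentiable_def partial_deriv_def vector_derivative_at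
      intro: differentiableI_vector)

lemma partial_deriv_add:
  assumes "partial_differentiable i f x" "partial_differentiable i g x"
  shows "partial_deriv i (\<lambda>x. f x + g x) x = partial_deriv i f x + partial_deriv i g x"
  using has_vector_derivative_add[OF has_vector_derivative_partial_deriv[of i f x 0]
      has_vector_derivative_partial_deriv[of i g x 0]] assms
  by (auto intro: partial_deriv_eqI(2))

lemma partial_deriv_scaleR:
  assumes "partial_differentiable i f x"
  shows "partial_deriv i (\<lambda>x. c *\<^sub>R f x) x = c *\<^sub>R partial_deriv i f x"
proof -
  have "((\<lambda>t. f (x + t *\<^sub>R axis i 1)) has_vector_derivative partial_deriv i f x) (at 0)"
    using has_vector_derivative_partial_deriv[of i f x 0] assms by simp
  from bounded_linear.has_vector_derivative[OF bounded_linear_scaleR_right[of c] this]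
  show ?thesis by (rule partial_deriv_eqI(2))
qed

lemma partial_deriv_vec_lambda:
  fixes f :: "'n::finite \<Rightarrow> real^'d::finite \<Rightarrow> real"
  assumes "\<And>k. partial_differentiable i (f k) x"
  shows "partial_differentiable i (\<lambda>x. \<chi> k. f k x) x"
    and "partial_deriv i (\<lambda>x. \<chi> k. f k x) x = (\<chi> k. partial_deriv i (f k) x)"
proof -
  have "((\<lambda>t. f k (x + t *\<^sub>R axis i 1)) has_vector_derivative partial_deriv i (f k) x) (at 0)" for k
    using has_vector_derivative_partial_deriv[of i "f k" x 0] assms by simp
  then have "((\<lambda>t. \<chi> k. f k (x + t *\<^sub>R axis i 1)) has_vector_derivative
      (\<chi> k. partial_deriv i (f k) x)) (at 0)"
    unfolding has_vector_derivative_def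
    by (subst has_derivative_componentwise_within)
      (auto simp: Basis_vec_def inner_axis)
  then show "partial_differentiable i (\<lambda>x. \<chi> k. f k x) x"
    and "partial_deriv i (\<lambda>x. \<chi> k. f k x) x = (\<chi> k. partial_deriv i (f k) x)"
    by (rule partial_deriv_eqI)+
qed

text \<open>The mean value theorem is applied twice, in direction \<open>i\<close> and then in
  direction \<open>j\<close>. The second difference is symmetric in \<open>i\<close> and
  \<open>j\<close>, whereas the derivative it yields depends on their order.\<close>

lemma second_difference_mean_value:
  fixes f :: "real^'d::finite \<Rightarrow> real"
  assumes f: "\<And>x. partial_differentiable i f x"
    and fi: "\<And>x. partial_differentiable j (partial_deriv i f) x"
    and h: "h > 0"
  obtains a b where "0 < a" "a < h" "0 < b" "b < h"
    "f (x + h *\<^sub>R axis i 1 + h *\<^sub>R axis j 1) - f (x + h *\<^sub>R axis i 1) - f (x + h *\<^sub>R axis j 1) + f x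
     = h\<^sup>2 * partial_deriv j (partial_deriv i f) (x + a *\<^sub>R axis i 1 + b *\<^sub>R axis j 1)"
proof -
  \<comment> \<open>The difference of \<open>f\<close> across opposite sides of the square; its
    increment from 0 to \<open>h\<close> is the second difference.\<close>
  let ?\<phi> = "\<lambda>t. f (x + h *\<^sub>R axis j 1 + t *\<^sub>R axis i 1) - f (x + t *\<^sub>R axis i 1)"
  have "(?\<phi> has_real_derivative partial_deriv i f (x + h *\<^sub>R axis j 1 + t *\<^sub>R axis i 1)
      - partial_deriv i f (x + t *\<^sub>R axis i 1)) (at t)" for t
    unfolding has_real_derivative_iff_has_vector_derivative
    by (intro has_vector_derivative_diff has_vector_derivative_partial_deriv f)
  from MVT2[OF h this] obtain a where a: "0 < a" "a < h"
    and eq1: "?\<phi> h - ?\<phi> 0 = h * (partial_deriv i f (x + h *\<^sub>R axis j 1 + a *\<^sub>R axis i 1)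
      - partial_deriv i f (x + a *\<^sub>R axis i 1))"
    by auto
  let ?\<psi> = "\<lambda>t. partial_deriv i f (x + a *\<^sub>R axis i 1 + t *\<^sub>R axis j 1)"
  have "(?\<psi> has_real_derivative
      partial_deriv j (partial_deriv i f) (x + a *\<^sub>R axis i 1 + t *\<^sub>R axis j 1)) (at t)" for t
    unfolding has_real_derivative_iff_has_vector_derivative
    by (intro has_vector_derivative_partial_deriv fi)
  from MVT2[OF h this] obtain b where b: "0 < b" "b < h"
    and eq2: "?\<psi> h - ?\<psi> 0 =
      h * partial_deriv j (partial_deriv i f) (x + a *\<^sub>R axis i 1 + b *\<^sub>R axis j 1)"
    by auto
  show ?thesis
    using that[OF a b] eq1 eq2 by (simp add: power2_eq_square algebra_simps)
qed

text \<open>Both mixed derivatives, at suitable points near \<open>x\<close>, equal the same second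
  difference quotient; the points shrink to \<open>x\<close> and continuity gives equality
  there.\<close>

theorem partial_deriv_commute:
  fixes f :: "real^'d::finite \<Rightarrow> real"
  assumes fi: "\<And>x. partial_differentiable i f x" and fj: "\<And>x. partial_differentiable j f x"
    and fij: "\<And>x. partial_differentiable j (partial_deriv i f) x"
    and fji: "\<And>x. partial_differentiable i (partial_deriv j f) x"
    and cij: "continuous_on UNIV (partial_deriv j (partial_deriv i f))"
    and cji: "continuous_on UNIV (partial_deriv i (partial_deriv j f))"
  shows "partial_deriv i (partial_deriv j f) = partial_deriv j (partial_deriv i f)"
proof
  fix x :: "real^'d"
  let ?h = "\<lambda>n. inverse (real (Suc n))"
  let ?A = "\<lambda>(i::'d) j a b. x + a *\<^sub>R axis i 1 + b *\<^sub>R axis j (1::real)"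
  have "\<exists>a b c d. (0 < a \<and> a < ?h n \<and> 0 < b \<and> b < ?h n) \<and> (0 < c \<and> c < ?h n \<and> 0 < d \<and> d < ?h n) \<and>
      partial_deriv j (partial_deriv i f) (?A i j a b) = partial_deriv i (partial_deriv j f) (?A j i c d)" for n
  proof -
    have h: "?h n > 0" by simp
    obtain a b where ab: "0 < a" "a < ?h n" "0 < b" "b < ?h n"
      "f (?A i j (?h n) (?h n)) - f (x + ?h n *\<^sub>R axis i 1) - f (x + ?h n *\<^sub>R axis j 1) + f x
      = (?h n)\<^sup>2 * partial_deriv j (partial_deriv i f) (?A i j a b)"
      by (rule second_difference_mean_value[OF fi fij h])
    obtain c d where cd: "0 < c" "c < ?h n" "0 < d" "d < ?h n"
      "f (?A j i (?h n) (?h n)) - f (x + ?h n *\<^sub>R axis j 1) - f (x + ?h n *\<^sub>R axis i 1) + f x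
      = (?h n)\<^sup>2 * partial_deriv i (partial_deriv j f) (?A j i c d)"
      by (rule second_difference_mean_value[OF fj fji h])
    \<comment> \<open>The far corner of the square is the same in either order, so the two second
      differences agree.\<close>
    have swap: "?A j i (?h n) (?h n) = ?A i j (?h n) (?h n)" by (simp add: algebra_simps)
    have "(?h n)\<^sup>2 * partial_deriv j (partial_deriv i f) (?A i j a b)
        = (?h n)\<^sup>2 * partial_deriv i (partial_deriv j f) (?A j i c d)"
      using ab(5) cd(5)[unfolded swap] by linarith
    then show ?thesis using ab cd h by (metis less_irrefl mult_cancel_left power_eq_0_iff)
  qed
  then obtain a b c d where
    ab: "\<And>n. 0 < a n \<and> a n < ?h n \<and> 0 < b n \<and> b n < ?h n" and
    cd: "\<And>n. 0 < c n \<and> c n < ?h n \<and> 0 < d n \<and> d n < ?h n" and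
    eq: "\<And>n. partial_deriv j (partial_deriv i f) (?A i j (a n) (b n))
      = partial_deriv i (partial_deriv j f) (?A j i (c n) (d n))"
    by metis
  have squeeze: "u \<longlonglongrightarrow> 0" if "\<And>n. 0 < u n \<and> u n < ?h n" for u
  proof (rule tendsto_sandwich[OF _ _ tendsto_const LIMSEQ_inverse_real_of_nat])
    show "\<forall>\<^sub>F n in sequentially. 0 \<le> u n" "\<forall>\<^sub>F n in sequentially. u n \<le> ?h n"
      by (rule always_eventually, use that less_imp_le in blast)+
  qed
  have lim: "(\<lambda>n. ?A k l (u n) (v n)) \<longlonglongrightarrow> x"
    if "\<And>n. 0 < u n \<and> u n < ?h n" "\<And>n. 0 < v n \<and> v n < ?h n" for u v k l
    using tendsto_add[OF tendsto_add[OF tendsto_const[of x]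
          tendsto_scaleR[OF squeeze[OF that(1)] tendsto_const[of "axis k 1"]]]
        tendsto_scaleR[OF squeeze[OF that(2)] tendsto_const[of "axis l 1"]]]
    by simp
  have "(\<lambda>n. partial_deriv j (partial_deriv i f) (?A i j (a n) (b n)))
      \<longlonglongrightarrow> partial_deriv j (partial_deriv i f) x"
    using ab by (intro continuous_on_tendsto_compose[OF cij] lim) auto
  moreover have "(\<lambda>n. partial_deriv i (partial_deriv j f) (?A j i (c n) (d n)))
      \<longlonglongrightarrow> partial_deriv i (partial_deriv j f) x"
    using cd by (intro continuous_on_tendsto_compose[OF cji] lim) auto
  ultimately show "partial_deriv i (partial_deriv j f) x = partial_deriv j (partial_deriv i f) x"
    unfolding eq by (rule LIMSEQ_unique[symmetric])
qed

section \<open>Boundedness, independence of the order of differentiation, control by the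
  norm\<close>

section \<open>The spaces \<open>C0\<close>\<close>

lemma C0_partial_differentiable:
  "\<lbrakk>u \<in> C0 s; length js < s\<rbrakk> \<Longrightarrow> partial_differentiable i (iter_partial js u) x"
  by (simp add: C0_def)

lemma C0_continuous: "\<lbrakk>u \<in> C0 s; length js \<le> s\<rbrakk> \<Longrightarrow> continuous_on UNIV (iter_partial js u)"
  by (simp add: C0_def)

lemma C0_tendsto: "\<lbrakk>u \<in> C0 s; length js \<le> s\<rbrakk> \<Longrightarrow> (iter_partial js u \<longlongrightarrow> 0) at_infinity"
  by (simp add: C0_def)

text \<open>Small outside a ball, compact image on the ball. This makes the suprema in
  \<open>C0_norm\<close> suprema of bounded sets.\<close>

lemma bounded_range_vanishing_at_infinity:
  fixes f :: "'a::euclidean_space \<Rightarrow> 'b::real_normed_vector"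
  assumes cont: "continuous_on UNIV f" and lim: "(f \<longlongrightarrow> 0) at_infinity"
  shows "bounded (range f)"
proof -
  obtain r where r: "\<And>x. norm x \<ge> r \<Longrightarrow> norm (f x) < 1"
    using tendstoD[OF lim, of 1] by (auto simp: eventually_at_infinity)
  have "compact (f ` cball 0 r)"
    using cont by (intro compact_continuous_image) (auto intro: continuous_on_subset)
  then obtain B where B: "\<And>x. norm x \<le> r \<Longrightarrow> norm (f x) \<le> B"
    by (force dest!: compact_imp_bounded simp: bounded_iff)
  have "norm (f x) \<le> max 1 B" for x
    using r[of x] B[of x] by (cases "norm x \<le> r") (auto simp: max_def)
  then show ?thesis by (auto simp: bounded_iff)
qed

lemma bdd_above_norm_iter_partial:
  assumes "u \<in> C0 s" "length js \<le> s"
  shows "bdd_above (range (\<lambda>x. norm (iter_partial js u x)))"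
  using bounded_range_vanishing_at_infinity[OF C0_continuous[OF assms] C0_tendsto[OF assms]]
  by (auto simp: bounded_iff bdd_above_def)

text \<open>The index \<open>i\<close> is moved past the entries of \<open>xs\<close> one at a time.
  The strict bound accounts for \<open>i\<close> itself: the whole list has length at most
  \<open>s\<close>.\<close>

lemma iter_partial_move_front:
  fixes f :: "real^'d::finite \<Rightarrow> real"
  assumes "f \<in> C0 s" "length xs + length ys < s"
  shows "iter_partial (xs @ i # ys) f = iter_partial (i # xs @ ys) f"
  using assms(2)
proof (induction xs)
  case (Cons k xs)
  \<comment> \<open>By the induction hypothesis \<open>i\<close> already stands directly behind
    \<open>k\<close>, so only the two outermost derivatives of \<open>?g\<close> have to be
    exchanged.\<close>
  let ?g = "iter_partial (xs @ ys) f"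
  have diff: "partial_differentiable l ?g x"
    "partial_differentiable l (partial_deriv l' ?g) x" for l l' x
    using C0_partial_differentiable[OF assms(1), of "xs @ ys"] Cons.prems
      C0_partial_differentiable[OF assms(1), of "l' # xs @ ys"] by auto
  have "continuous_on UNIV (partial_deriv l (partial_deriv l' ?g))" for l l'
    using C0_continuous[OF assms(1), of "l # l' # xs @ ys"] Cons.prems by simp
  then have "partial_deriv k (partial_deriv i ?g) = partial_deriv i (partial_deriv k ?g)"
    using diff by (intro partial_deriv_commute)
  then show ?case using Cons by simp
qed simp

text \<open>The head of \<open>js\<close> occurs in \<open>ks\<close>; it is moved to the front
  there, and induction treats the tails.\<close>

lemma iter_partial_perm:
  fixes f :: "real^'d::finite \<Rightarrow> real"
  assumes "f \<in> C0 s" "length js \<le> s" "mset js = mset ks"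
  shows "iter_partial js f = iter_partial ks f"
  using assms(2,3)
proof (induction js arbitrary: ks)
  case (Cons i js)
  then have "i \<in> set ks" by (metis list.set_intros(1) mset_eq_setD)
  then obtain xs ys where ks: "ks = xs @ i # ys" by (metis split_list)
  have "length (i # js) = length ks" using Cons.prems(2) by (rule mset_eq_length)
  then have "iter_partial ks f = iter_partial (i # xs @ ys) f"
    using Cons.prems by (simp add: ks iter_partial_move_front[OF assms(1)])
  then show ?case using Cons.IH[of "xs @ ys"] Cons.prems by (simp add: ks)
qed simp

text \<open>Over a finite type every such function is the count of a multiset. Hence the choice in
  \<open>multi_partial\<close> has a witness.\<close>

lemma ex_multi_index_list:
  fixes p :: "'d::finite \<Rightarrow> nat"
  obtains js where "\<And>i. count_list js i = p i"
proof -
  obtain js where "mset js = Abs_multiset p" using ex_mset by blast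
  moreover have "count (Abs_multiset p) = p" by (simp add: Abs_multiset_inverse)
  ultimately show ?thesis using that by (metis count_mset)
qed

text \<open>The list picked by the choice operator is a permutation of \<open>js\<close>.\<close>

lemma multi_partial_eq_iter_partial:
  fixes f :: "real^'d::finite \<Rightarrow> real"
  assumes "f \<in> C0 s" "length js \<le> s"
  shows "multi_partial (count_list js) f = iter_partial js f"
proof -
  define ks where "ks = (SOME ks. \<forall>i. count_list ks i = count_list js i)"
  have "\<forall>i. count_list ks i = count_list js i"
    unfolding ks_def by (rule someI[of _ js]) simp
  then have "mset js = mset ks" by (intro multiset_eqI) (simp add: count_mset)
  from iter_partial_perm[OF assms this] show ?thesis
    by (simp add: multi_partial_def ks_def)
qed

lemma finite_multi_indices: "finite {p :: 'd::finite \<Rightarrow> nat. (\<Sum>i\<in>UNIV. p i) \<le> s}"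
proof (rule finite_subset)
  show "{p :: 'd \<Rightarrow> nat. (\<Sum>i\<in>UNIV. p i) \<le> s}
      \<subseteq> {p. \<forall>i. (i \<in> UNIV \<longrightarrow> p i \<in> {..s}) \<and> (i \<notin> UNIV \<longrightarrow> p i = 0)}"
  proof
    fix p :: "'d \<Rightarrow> nat"
    assume "p \<in> {p. (\<Sum>i\<in>UNIV. p i) \<le> s}"
    then have "p i \<le> s" for i using member_le_sum[of i UNIV p] by simp
    then show "p \<in> {p. \<forall>i. (i \<in> UNIV \<longrightarrow> p i \<in> {..s}) \<and> (i \<notin> UNIV \<longrightarrow> p i = 0)}" by simp
  qed
qed (intro finite_set_of_finite_funs; simp)

lemma sum_count_list_UNIV: "(\<Sum>i\<in>UNIV. count_list js i) = length (js :: 'd::finite list)"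
  by (rule sum_count_set) auto

text \<open>The supremum for the multi-index \<open>count_list js\<close> is one summand of the
  norm, and the other summands are nonnegative.\<close>

lemma norm_iter_partial_le_C0_norm:
  fixes f :: "real^'d::finite \<Rightarrow> real"
  assumes f: "f \<in> C0 s" and js: "length js \<le> s"
  shows "norm (iter_partial js f x) \<le> C0_norm s f"
proof -
  \<comment> \<open>Boundedness comes first: the supremum of an unbounded set of reals carries no
    information.\<close>
  have nonneg: "0 \<le> (SUP x. norm (multi_partial p f x))" if "(\<Sum>i\<in>UNIV. p i) \<le> s" for p
  proof -
    obtain ks where ks: "p = count_list ks" using ex_multi_index_list[of p] by (metis ext)
    then have "length ks \<le> s" using that by (simp add: sum_count_list_UNIV)
    then have "bdd_above (range (\<lambda>x. norm (multi_partial p f x)))"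
      using bdd_above_norm_iter_partial[OF f] multi_partial_eq_iter_partial[OF f] by (simp add: ks)
    from cSUP_upper2[OF this UNIV_I norm_ge_zero] show ?thesis .
  qed
  have "norm (iter_partial js f x) \<le> (SUP x. norm (iter_partial js f x))"
    using bdd_above_norm_iter_partial[OF f js] by (intro cSUP_upper) auto
  also have "\<dots> = (SUP x. norm (multi_partial (count_list js) f x))"
    by (simp add: multi_partial_eq_iter_partial[OF f js])
  also have "\<dots> \<le> C0_norm s f"
    unfolding C0_norm_def using nonneg js
    by (intro member_le_sum finite_multi_indices) (auto simp: sum_count_list_UNIV)
  finally show ?thesis .
qed

section \<open>The gradient as a bounded linear injection, and representers of partial
  derivatives\<close>

section \<open>Gradients\<close>

text \<open>The derivative coming from the gradient is applied first and so stands last in the list;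
  the strict bound leaves room for it.\<close>

lemma iter_partial_grad:
  assumes f: "f \<in> C0 s" and js: "length js < s"
  shows "iter_partial js (grad f) = (\<lambda>x. \<chi> i. iter_partial (js @ [i]) f x)"
  using js
proof (induction js)
  case (Cons k js)
  have "partial_deriv k (\<lambda>x. \<chi> i. iter_partial (js @ [i]) f x) x
      = (\<chi> i. partial_deriv k (iter_partial (js @ [i]) f) x)" for x
    using Cons.prems by (intro partial_deriv_vec_lambda C0_partial_differentiable[OF f]) simp
  then show ?case using Cons by auto
qed (auto simp: grad_def)

lemma grad_mem_C0:
  assumes f: "f \<in> C0 s" and s: "s \<ge> 1"
  shows "grad f \<in> C0 (s - 1)"
  unfolding C0_def mem_Collect_eq
proof (intro conjI allI impI)
  fix js :: "'a list" and i x
  assume "length js < s - 1"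
  then show "partial_differentiable i (iter_partial js (grad f)) x"
    using C0_partial_differentiable[OF f]
    by (subst iter_partial_grad[OF f]) (auto intro!: partial_deriv_vec_lambda)
next
  fix js :: "'a list"
  assume "length js \<le> s - 1"
  \<comment> \<open>Subtraction is truncated, so \<open>s \<ge> 1\<close> is used for this
    passage.\<close>
  then have js: "length js < s" using s by simp
  show "continuous_on UNIV (iter_partial js (grad f))"
    unfolding iter_partial_grad[OF f js] using js
    by (intro continuous_on_vec_lambda C0_continuous[OF f]) simp
  have "((\<lambda>x. \<chi> i. iter_partial (js @ [i]) f x) \<longlongrightarrow> (\<chi> i. 0)) at_infinity"
    using js by (intro tendsto_vec_lambda C0_tendsto[OF f]) simp
  then show "(iter_partial js (grad f) \<longlongrightarrow> 0) at_infinity"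
    by (simp add: iter_partial_grad[OF f js] zero_vec_def)
qed

text \<open>The Euclidean norm is at most the sum of the \<open>CARD('d)\<close> components, each a
  derivative of \<open>f\<close> of order at most \<open>s\<close>; the other factor of the constant
  counts the multi-indices.\<close>

lemma C0_norm_grad_le:
  fixes s :: nat
  assumes s: "s \<ge> 1"
  shows "\<exists>N\<ge>0. \<forall>f\<in>C0 s. C0_norm (s - 1) (grad f :: real^'d \<Rightarrow> real^'d::finite) \<le> N * C0_norm s f"
proof (intro exI[of _ "real (card {p :: 'd \<Rightarrow> nat. (\<Sum>i\<in>UNIV. p i) \<le> s - 1}) * real CARD('d)"]
    conjI ballI)
  fix f :: "real^'d \<Rightarrow> real"
  assume f: "f \<in> C0 s"
  have "(SUP x. norm (multi_partial p (grad f) x)) \<le> real CARD('d) * C0_norm s f"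
    if p: "(\<Sum>i\<in>UNIV. p i) \<le> s - 1" for p :: "'d \<Rightarrow> nat"
  proof (rule cSUP_least)
    fix x
    \<comment> \<open>The list chosen inside \<open>multi_partial\<close> is kept as it is, since
      reordering is available for real-valued functions and \<open>grad f\<close> is
      vector-valued.\<close>
    define js where "js = (SOME js. \<forall>i. count_list js i = p i)"
    have "\<forall>i. count_list js i = p i"
      unfolding js_def by (rule someI_ex) (metis ex_multi_index_list)
    then have "length js \<le> s - 1" using p sum_count_list_UNIV[of js] by simp
    then have js: "length js < s" using s by simp
    have "norm (multi_partial p (grad f) x) = norm (iter_partial js (grad f) x)"
      by (simp add: multi_partial_def js_def)
    also have "\<dots> \<le> (\<Sum>i\<in>UNIV. \<bar>iter_partial js (grad f) x $ i\<bar>)"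
      by (rule norm_le_l1_cart)
    also have "\<dots> = (\<Sum>i\<in>UNIV. norm (iter_partial (js @ [i]) f x))"
      by (simp add: iter_partial_grad[OF f js])
    also have "\<dots> \<le> real CARD('d) * C0_norm s f"
      using js by (intro sum_bounded_above norm_iter_partial_le_C0_norm[OF f]) simp
    finally show "norm (multi_partial p (grad f) x) \<le> real CARD('d) * C0_norm s f" .
  qed simp
  then show "C0_norm (s - 1) (grad f)
      \<le> real (card {p :: 'd \<Rightarrow> nat. (\<Sum>i\<in>UNIV. p i) \<le> s - 1}) * real CARD('d) * C0_norm s f"
    unfolding C0_norm_def[of "s - 1"] mult.assoc by (intro sum_bounded_above) simp
qed simp

lemma grad_add:
  assumes "\<And>i x. partial_differentiable i f x" "\<And>i x. partial_differentiable i g x"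
  shows "grad (\<lambda>x. f x + g x) = (\<lambda>x. grad f x + grad g x)"
  using assms by (auto simp: grad_def partial_deriv_add vec_eq_iff fun_eq_iff)

lemma grad_scaleR:
  assumes "\<And>i x. partial_differentiable i f x"
  shows "grad (\<lambda>x. c *\<^sub>R f x) = (\<lambda>x. c *\<^sub>R grad f x)"
  using partial_deriv_scaleR[OF assms] by (auto simp: grad_def vec_eq_iff fun_eq_iff)

lemma grad_diff:
  assumes f: "\<And>i x. partial_differentiable i f x" and g: "\<And>i x. partial_differentiable i g x"
  shows "grad (\<lambda>x. f x - g x) = (\<lambda>x. grad f x - grad g x)"
proof -
  have "partial_deriv i (\<lambda>x. f x - g x) x = partial_deriv i f x - partial_deriv i g x" for i x
    using has_vector_derivative_diff[OF has_vector_derivative_partial_deriv[of i f x 0]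
        has_vector_derivative_partial_deriv[of i g x 0]] f g
    by (auto intro: partial_deriv_eqI(2))
  then show ?thesis by (auto simp: grad_def vec_eq_iff fun_eq_iff)
qed

lemma grad_sum_scaleR:
  assumes "\<And>j i x. j \<in> J \<Longrightarrow> partial_differentiable i (f j) x"
  shows "grad (\<lambda>x. \<Sum>j\<in>J. c j *\<^sub>R f j x) = (\<lambda>x. \<Sum>j\<in>J. c j *\<^sub>R grad (f j) x)"
proof -
  have "partial_deriv i (\<lambda>x. \<Sum>j\<in>J. c j *\<^sub>R f j x) x = (\<Sum>j\<in>J. c j *\<^sub>R partial_deriv i (f j) x)"
    for i x
  proof (rule partial_deriv_eqI(2), rule has_vector_derivative_sum)
    fix j assume "j \<in> J"
    then have "((\<lambda>t. f j (x + t *\<^sub>R axis i 1)) has_vector_derivative partial_deriv i (f j) x) (at 0)"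
      using has_vector_derivative_partial_deriv[of i "f j" x 0] assms by simp
    then show "((\<lambda>t. c j *\<^sub>R f j (x + t *\<^sub>R axis i 1)) has_vector_derivative
        c j *\<^sub>R partial_deriv i (f j) x) (at 0)"
      by (rule bounded_linear.has_vector_derivative[OF bounded_linear_scaleR_right])
  qed
  then show ?thesis by (auto simp: grad_def vec_eq_iff fun_eq_iff)
qed

lemma grad_eq_0_imp_eq_0:
  fixes f :: "real^'d::finite \<Rightarrow> real"
  assumes diff: "\<And>i x. partial_differentiable i f x" and lim: "(f \<longlongrightarrow> 0) at_infinity"
    and grad: "\<And>x. grad f x = 0"
  shows "f x = 0"
proof -
  \<comment> \<open>A single coordinate direction is enough: the line through \<open>x\<close>
    leaves every ball.\<close>
  fix i :: 'd
  have "partial_deriv i f y = 0" for y using grad[of y] by (simp add: grad_def vec_eq_iff)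
  then have "((\<lambda>t. f (x + t *\<^sub>R axis i 1)) has_real_derivative 0) (at t)" for t
    using has_vector_derivative_partial_deriv[OF diff, where x = x and i = i and t = t]
    by (simp add: has_real_derivative_iff_has_vector_derivative)
  then have const: "f (x + t *\<^sub>R axis i 1) = f x" for t
    using DERIV_isconst_all[of "\<lambda>t. f (x + t *\<^sub>R axis i 1)" t 0] by simp
  have "filterlim (\<lambda>t::real. x + t *\<^sub>R axis i (1::real)) at_infinity at_top"
    unfolding filterlim_at_infinity[OF order_refl]
  proof (intro allI impI)
    fix r :: real
    \<comment> \<open>Reverse triangle inequality: the norm is at least
      \<open>t - norm x\<close>.\<close>
    have "r \<le> norm (x + t *\<^sub>R axis i (1::real))" if "t \<ge> r + norm x" for t
    proof -
      have "t \<le> norm (t *\<^sub>R axis i (1::real))" by simp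
      then show ?thesis using norm_diff_ineq[of "t *\<^sub>R axis i (1::real)" x] that
        by (simp add: add.commute)
    qed
    then show "\<forall>\<^sub>F t in at_top. r \<le> norm (x + t *\<^sub>R axis i (1::real))"
      using eventually_at_top_linorder by blast
  qed
  then have "((\<lambda>t. f (x + t *\<^sub>R axis i 1)) \<longlongrightarrow> 0) at_top"
    using lim filterlim_compose by blast
  then show "f x = 0" by (simp add: const tendsto_const_iff)
qed

lemma has_reproducing_property_scalarD:
  fixes K :: "'a \<Rightarrow> 'a \<Rightarrow> real"
  assumes "has_reproducing_property (*) H ip K"
  shows "(\<lambda>y. K y x) \<in> H" and "u \<in> H \<Longrightarrow> ip (\<lambda>y. K y x) u = u x"
  using assms[unfolded has_reproducing_property_def, rule_format, of x 1] by auto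

text \<open>Each side is an inner product of the two kernel sections at \<open>x\<close> and
  \<open>y\<close>, in opposite orders.\<close>

lemma reproducing_kernel_symmetric:
  fixes K :: "'a \<Rightarrow> 'a \<Rightarrow> real"
  assumes "function_hilbert_space H ip" and K: "has_reproducing_property (*) H ip K"
  shows "K x y = K y x"
  using function_hilbert_space.ip_commute[OF assms(1)] has_reproducing_property_scalarD[OF K] by metis

text \<open>Evaluating a derivative at a point is linear and bounded by the norm of
  \<open>C0 s\<close>, hence by that of \<open>H\<close>, so Riesz representation applies.\<close>

lemma partial_deriv_representer:
  fixes H :: "(real^'d::finite \<Rightarrow> real) set"
  assumes "function_hilbert_space H ip"
    and incl: "continuously_included H (ip_norm ip) (C0 s) (C0_norm s)" and s: "s \<ge> 1"
  shows "\<exists>g\<in>H. \<forall>f\<in>H. ip g f = partial_deriv i f x"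
proof -
  interpret function_hilbert_space H ip by fact
  have C0: "f \<in> C0 s" if "f \<in> H" for f using incl that by (auto simp: continuously_included_def)
  have diff: "partial_differentiable i f x" if "f \<in> H" for f i x
    using C0_partial_differentiable[OF C0[OF that], of "[]"] s by simp
  \<comment> \<open>Continuity of the inclusion at the zero function with tolerance 1.\<close>
  obtain \<delta> where \<delta>: "\<delta> > 0" "\<And>f. \<lbrakk>f \<in> H; ip_norm ip f < \<delta>\<rbrakk> \<Longrightarrow> C0_norm s f < 1"
    using incl[unfolded continuously_included_def, THEN conjunct2, rule_format, OF zero_closed, of 1]
    by auto
  have add: "partial_deriv i (\<lambda>x. f x + g x) x = partial_deriv i f x + partial_deriv i g x"
    if "f \<in> H" "g \<in> H" for f g using that by (intro partial_deriv_add diff)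
  have scale: "partial_deriv i (\<lambda>x. c *\<^sub>R f x) x = c * partial_deriv i f x" if "f \<in> H" for f c
    using partial_deriv_scaleR[OF diff[OF that]] by simp
  have "\<bar>partial_deriv i f x\<bar> \<le> 1" if "f \<in> H" "ip_norm ip f < \<delta>" for f
    using norm_iter_partial_le_C0_norm[OF C0[OF that(1)], of "[i]" x] \<delta>(2)[OF that] s by simp
  then have "\<bar>partial_deriv i f x\<bar> \<le> 2 / \<delta> * ip_norm ip f" if "f \<in> H" for f
    using linear_functional_bounded[of "\<lambda>f. partial_deriv i f x" \<delta>, OF scale \<delta>(1) _ that] by blast
  then show ?thesis
    using riesz_representation[of "\<lambda>f. partial_deriv i f x", OF add scale] by blast
qed

section \<open>The Hilbert space of gradients and its reproducing kernel\<close>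

theorem proposition4p1:
  fixes s :: nat
    and H :: "(real^'d::finite \<Rightarrow> real) set"
    and ipH :: "(real^'d \<Rightarrow> real) \<Rightarrow> (real^'d \<Rightarrow> real) \<Rightarrow> real"
    and K\<^sub>H :: "real^'d \<Rightarrow> real^'d \<Rightarrow> real"
  assumes "CARD('d) \<ge> 2"
    and "s \<ge> 1"
    and "function_hilbert_space H ipH"
    and "continuously_included H (ip_norm ipH) (C0 s) (C0_norm s)"
    and "is_reproducing_kernel (*) H ipH K\<^sub>H"
  shows "inj_on grad H
    \<and> function_hilbert_space (grad_space H) (grad_ip H ipH)
    \<and> continuously_included (grad_space H) (ip_norm (grad_ip H ipH)) (C0 (s - 1)) (C0_norm (s - 1))
    \<and> kernel_partials_exist K\<^sub>H
    \<and> is_reproducing_kernel (*v) (grad_space H) (grad_ip H ipH) (grad1_grad2T K\<^sub>H)"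
proof -
  interpret H: function_hilbert_space H ipH by fact
  have C0: "f \<in> C0 s" if "f \<in> H" for f
    using assms(4) that by (auto simp: continuously_included_def)
  have diff: "partial_differentiable i f x" if "f \<in> H" for f i x
    using C0_partial_differentiable[OF C0[OF that], of "[]"] assms(2) by simp
  have grad_diff': "grad (\<lambda>x. f x - g x) = (\<lambda>x. grad f x - grad g x)" if "f \<in> H" "g \<in> H" for f g
    using that by (intro grad_diff diff)
  have space: "grad_space H = grad ` H" by (auto simp: grad_space_def)

  have inj: "inj_on grad H"
  proof (rule inj_onI)
    fix f g assume fg: "f \<in> H" "g \<in> H" and eq: "grad f = grad g"
    let ?h = "\<lambda>x. f x - g x"
    have h: "?h \<in> H" using fg by (rule H.diff_closed)
    have lim: "(?h \<longlongrightarrow> 0) at_infinity" using C0_tendsto[OF C0[OF h], of "[]"] by simp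
    have "grad ?h x = 0" for x using grad_diff'[OF fg] eq by simp
    then have "?h x = 0" for x using grad_eq_0_imp_eq_0[OF diff[OF h] lim] by blast
    then show "f = g" by (simp add: fun_eq_iff)
  qed
  \<comment> \<open>Injectivity lets \<open>the_inv_into\<close> recover \<open>f\<close> from
    \<open>grad f\<close>; every property of the new inner product is transported through this
    identity.\<close>
  have isometry: "grad_ip H ipH (grad f) (grad g) = ipH f g" if "f \<in> H" "g \<in> H" for f g
    using that by (simp add: grad_ip_def the_inv_into_f_f[OF inj])
  have hilbert: "function_hilbert_space (grad_space H) (grad_ip H ipH)"
    unfolding space
    by (rule function_hilbert_space_image[OF assms(3)])
      (intro grad_add grad_scaleR isometry diff; assumption)+

  have incl: "continuously_included (grad_space H) (ip_norm (grad_ip H ipH)) (C0 (s - 1)) (C0_norm (s - 1))"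
    unfolding continuously_included_def space
  proof (intro conjI ballI allI impI)
    show "grad ` H \<subseteq> C0 (s - 1)" using C0 grad_mem_C0 assms(2) by blast
  next
    fix v :: "real^'d \<Rightarrow> real^'d" and e :: real
    assume "v \<in> grad ` H" and e: "e > 0"
    then obtain f where f: "f \<in> H" "v = grad f" by blast
    obtain N where N: "N \<ge> 0"
      "\<And>h :: real^'d \<Rightarrow> real. h \<in> C0 s \<Longrightarrow> C0_norm (s - 1) (grad h) \<le> N * C0_norm s h"
      using C0_norm_grad_le[OF assms(2)] by blast
    \<comment> \<open>The summand 1 avoids division by zero and makes
      \<open>N * (e / (N + 1))\<close> strictly smaller than \<open>e\<close>.\<close>
    have "e / (N + 1) > 0" using e N(1) by simp
    then obtain \<delta> where \<delta>: "\<delta> > 0"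
      "\<And>g. \<lbrakk>g \<in> H; ip_norm ipH (\<lambda>x. g x - f x) < \<delta>\<rbrakk> \<Longrightarrow> C0_norm s (\<lambda>x. g x - f x) < e / (N + 1)"
      using assms(4) f(1) unfolding continuously_included_def by blast
    have "C0_norm (s - 1) (\<lambda>x. grad g x - v x) < e"
      if g: "g \<in> H" and less: "ip_norm (grad_ip H ipH) (\<lambda>x. grad g x - v x) < \<delta>" for g
    proof -
      let ?h = "\<lambda>x. g x - f x"
      have h: "?h \<in> H" using g f(1) by (rule H.diff_closed)
      have eq: "(\<lambda>x. grad g x - v x) = grad ?h" using grad_diff'[OF g f(1)] f(2) by simp
      have "ip_norm ipH ?h < \<delta>" using less isometry[OF h h] by (simp add: eq ip_norm_def)
      then have "C0_norm s ?h < e / (N + 1)" using \<delta>(2)[OF g] by simp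
      then have "N * C0_norm s ?h \<le> N * (e / (N + 1))" using N(1) by (intro mult_left_mono) auto
      also have "\<dots> < e" using e N(1) by (simp add: field_simps)
      finally show ?thesis using N(2)[OF C0[OF h]] by (simp add: eq)
    qed
    then show "\<exists>\<delta>>0. \<forall>w\<in>grad ` H. ip_norm (grad_ip H ipH) (\<lambda>x. w x - v x) < \<delta>
        \<longrightarrow> C0_norm (s - 1) (\<lambda>x. w x - v x) < e"
      using \<delta>(1) by blast
  qed

  have K: "has_reproducing_property (*) H ipH K\<^sub>H"
    using assms(5) by (simp add: is_reproducing_kernel_def)
  note K_mem = has_reproducing_property_scalarD(1)[OF K]
    and K_ip = has_reproducing_property_scalarD(2)[OF K]
    and K_sym = reproducing_kernel_symmetric[OF assms(3) K]
  \<comment> \<open>The function \<partial>_{2,j} K_H(., y), to be identified with the representer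
    of the \<open>j\<close>-th derivative at \<open>y\<close>.\<close>
  define G where "G j y = (\<lambda>x. partial_deriv j (\<lambda>y'. K\<^sub>H x y') y)" for j y
  have G: "G j y \<in> H \<and> (\<forall>f\<in>H. ipH (G j y) f = partial_deriv j f y)" for j y
  proof -
    obtain g where g: "g \<in> H" "\<And>f. f \<in> H \<Longrightarrow> ipH g f = partial_deriv j f y"
      using partial_deriv_representer[OF assms(3,4,2)] by blast
    have "g x = G j y x" for x
    proof -
      \<comment> \<open>The kernel evaluates \<open>g\<close> at \<open>x\<close>; read the other
        way round, \<open>g\<close> differentiates the kernel section at \<open>x\<close>. Symmetry
        then moves the derivative to the second argument.\<close>
      have "g x = ipH (\<lambda>y. K\<^sub>H y x) g" using K_ip[OF g(1)] by simp
      also have "\<dots> = ipH g (\<lambda>y. K\<^sub>H y x)" using K_mem g(1) by (rule H.ip_commute)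
      also have "\<dots> = partial_deriv j (\<lambda>y. K\<^sub>H y x) y" using g(2) K_mem by blast
      also have "(\<lambda>y. K\<^sub>H y x) = (\<lambda>y. K\<^sub>H x y)" using K_sym by blast
      finally show ?thesis by (simp add: G_def)
    qed
    then show ?thesis using g by (metis ext)
  qed
  have G_mem: "G j y \<in> H" and G_ip: "f \<in> H \<Longrightarrow> ipH (G j y) f = partial_deriv j f y" for j y f
    using G by auto

  have partials: "kernel_partials_exist K\<^sub>H"
  proof -
    \<comment> \<open>Symmetry gives the inner derivative; the outer one exists because
      \<open>G j y\<close> lies in \<open>H\<close>.\<close>
    have "(\<lambda>y. K\<^sub>H x y) \<in> H" for x using K_mem[of x] K_sym[of x] by simp
    then show ?thesis
      using diff G_mem by (auto simp: kernel_partials_exist_def G_def)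
  qed

  have "has_reproducing_property (*v) (grad_space H) (grad_ip H ipH) (grad1_grad2T K\<^sub>H)"
    unfolding has_reproducing_property_def space
  proof (intro allI)
    fix y \<alpha> :: "real^'d"
    \<comment> \<open>Column \<open>j\<close> of the matrix kernel at \<open>(x, y)\<close> is
      \<open>grad (G j y) x\<close>, so applying the matrix to \<alpha> gives the gradient of this
      combination.\<close>
    define F where "F = (\<lambda>x. \<Sum>j\<in>UNIV. \<alpha> $ j *\<^sub>R G j y x)"
    have F: "F \<in> H" unfolding F_def by (intro H.sum_closed H.scale_closed G_mem)
    have "grad F = (\<lambda>x. \<Sum>j\<in>UNIV. \<alpha> $ j *\<^sub>R grad (G j y) x)"
      unfolding F_def by (intro grad_sum_scaleR diff G_mem)
    then have eq: "(\<lambda>x. grad1_grad2T K\<^sub>H x y *v \<alpha>) = grad F"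
      by (simp add: fun_eq_iff vec_eq_iff grad1_grad2T_def grad_def G_def matrix_vector_mult_def
          mult.commute)
    have "grad_ip H ipH (grad F) (grad f) = \<alpha> \<bullet> grad f y" if f: "f \<in> H" for f
    proof -
      have "ipH F f = (\<Sum>j\<in>UNIV. ipH (\<lambda>x. \<alpha> $ j *\<^sub>R G j y x) f)"
        unfolding F_def by (intro H.ip_sum_left H.scale_closed G_mem f)
      also have "\<dots> = \<alpha> \<bullet> grad f y"
        by (simp only: H.ip_scale_left[OF G_mem f] G_ip[OF f]) (simp add: inner_vec_def grad_def)
      finally show ?thesis using isometry[OF F f] by simp
    qed
    then show "(\<lambda>x. grad1_grad2T K\<^sub>H x y *v \<alpha>) \<in> grad ` H \<and>
        (\<forall>u\<in>grad ` H. grad_ip H ipH (\<lambda>x. grad1_grad2T K\<^sub>H x y *v \<alpha>) u = \<alpha> \<bullet> u y)"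
      using F by (auto simp: eq)
  qed
  \<comment> \<open>Two kernels whose matrices agree on every vector are equal.\<close>
  then have "is_reproducing_kernel (*v) (grad_space H) (grad_ip H ipH) (grad1_grad2T K\<^sub>H)"
    unfolding is_reproducing_kernel_def
    using has_reproducing_property_unique[OF hilbert] by (auto simp: fun_eq_iff matrix_eq)
  with inj hilbert incl partials show ?thesis by blast
qed

end
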